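(* Let a universal constant $C>0$, an initial point $x_0\in\mathrm{dom}\,h$, a tolerance $\bar\varepsilon>0$, and an instance $(f,f';h)$ of the problem $\min\{\phi(x)=f(x)+h(x):x\in\mathbb{R}^n\}$ satisfying (A1)-(A3) for some parameter triple $(L_f,M_f,\mu)\in\mathbb{R}_+^3$ be given. If $\lambda>0$ satisfies $$\frac{\bar\varepsilon}{C(M_f^2+\bar\varepsilon L_f)}\le\lambda\le\frac{Cd_0^2}{\bar\varepsilon}$$ and $\tau$ is given by $$\tau=\left[1+\frac{(1+\lambda\mu)\bar\varepsilon}{8\lambda(M_f^2+\bar\varepsilon L_f)}\right]^{-1},$$ then any variant of GPB with input $(x_0,\lambda,\bar\varepsilon,\tau)$ obtains a $\bar\varepsilon$-solution of the instance $(f,f';h)$ of the problem $\min\{\phi(x)=f(x)+h(x):x\in\mathbb{R}^n\}$ in a number of iterations bounded, up to a logarithmic term, by $$\mathcal{O}\left(\min\left\{\frac{(M_f^2+\bar\varepsilon L_f)d_0^2}{\bar\varepsilon^2},\left(\frac{M_f^2+\bar\varepsilon L_f}{\mu\bar\varepsilon}+1\right)\log\left(\frac{\mu d_0^2}{\bar\varepsilon}+1\right)\right\}+1\right).$$ That is, there is a constant $C'>0$ depending only on $C$ such that the number of iterations is at most $C'\,\bigl(1+\log_+(4\bar t/\bar\varepsilon)\bigr)$ times the expression inside $\mathcal{O}(\cdot)$.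
   Context: Notation. $\|\cdot\|$ and $\langle\cdot,\cdot\rangle$ are the Euclidean norm and inner product on $\mathbb{R}^n$; $\log$ is the natural logarithm; $\log_+(s)=\max\{0,\log s\}$ for $s>0$ and $\log_+(0)=0$. For $\mu\ge0$, $\overline{\mathrm{Conv}}_\mu(\mathbb{R}^n)$ is the set of proper lower semicontinuous functions $\Psi:\mathbb{R}^n\to(-\infty,+\infty]$ such that $\Psi-\mu\|\cdot\|^2/2$ is convex; $\overline{\mathrm{Conv}}(\mathbb{R}^n)$ is the case $\mu=0$. Problem. $\phi_*=\min\{\phi(x):=f(x)+h(x):x\in\mathbb{R}^n\}$. A $\bar\varepsilon$-solution is a point $\bar x\in\mathrm{dom}\,h$ with $\phi(\bar x)-\phi_*\le\bar\varepsilon$. The assumptions for a triple $(L_f,M_f,\mu)\in\mathbb{R}_+^3$ are: (A1) $f\in\overline{\mathrm{Conv}}(\mathbb{R}^n)$, $h\in\overline{\mathrm{Conv}}_\mu(\mathbb{R}^n)$, $\mathrm{dom}\,h\subset\mathrm{dom}\,f$, and $f':\mathrm{dom}\,h\to\mathbb{R}^n$ is a given function with $f'(x)\in\partial f(x)$ for all $x\in\mathrm{dom}\,h$; (A2) the set $X^*$ of optimal solutions is nonempty; (A3) $\|f'(x)-f'(y)\|\le2M_f+L_f\|x-y\|$ for all $x,y\in\mathrm{dom}\,h$. Let $\ell_f(u;x)=f(x)+\langle f'(x),u-x\rangle$, $x_0^*=\mathrm{argmin}\{\|x_0-x^*\|:x^*\in X^*\}$ and $d_0=\|x_0-x_0^*\|$.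 Let $\Omega\subset\mathbb{R}_+^2$ be the set of all pairs $(M,L)$ for which (A3) holds with $(M_f,L_f)=(M,L)$; $(\bar M_f,\bar L_f)$ is the unique minimizer of $M^2+\bar\varepsilon L$ over $\Omega$, and $T_{\bar\varepsilon}=(\bar M_f^2+\bar\varepsilon\bar L_f)^{1/2}$. Also $$\bar t:=\bar M_f^2+4(\bar L_f+2)\bigl(\max\{1,2\lambda\bar L_f\}d_0+\lambda\bar M_f\bigr)^2.$$ When $\mu=0$, the second term of the minimum in the bound is by convention equal to the first. GPB framework. The input is $x_0\in\mathrm{dom}\,h$, $\lambda>0$, $\bar\varepsilon>0$, $\tau\in(0,1)$ with $\frac{\tau}{1-\tau}\ge\frac{8\lambda T_{\bar\varepsilon}^2}{(1+\lambda\mu)\bar\varepsilon}$. Set $y_0=x_0$, $t_0=0$. For $j=1,2,\dots$: Step 1. If $t_{j-1}\le\bar\varepsilon/2$ (serious update), set $x_j^c=x_{j-1}$ and choose any $\Gamma_j\in\overline{\mathrm{Conv}}_\mu(\mathbb{R}^n)$ with $\ell_f(\cdot;x_{j-1})+h\le\Gamma_j\le\phi$. Otherwise (null update), set $x_j^c=x_{j-1}^c$ and choose any $\Gamma_j\in\overline{\mathrm{Conv}}_\mu(\mathbb{R}^n)$ such that $\tau\bar\Gamma+(1-\tau)[\ell_f(\cdot;x_{j-1})+h]\le\Gamma_j\le\phi$ for some $\bar\Gamma\in\overline{\mathrm{Conv}}_\mu(\mathbb{R}^n)$ with $\bar\Gamma(x_{j-1})=\Gamma_{j-1}(x_{j-1})$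 and $x_{j-1}=\mathrm{argmin}_u\{\bar\Gamma(u)+\frac1{2\lambda}\|u-x_{j-1}^c\|^2\}$. Step 2. Compute $x_j=\mathrm{argmin}_u\{\Gamma_j(u)+\frac1{2\lambda}\|u-x_j^c\|^2\}$, choose $y_j\in\mathrm{Argmin}\{\phi(x):x\in\{x_0,\dots,x_j\}\}$, and set $m_j=\Gamma_j(x_j)+\frac1{2\lambda}\|x_j-x_j^c\|^2$, $t_j=\phi(y_j)-m_j$. A "variant of GPB" is any method whose iterations are of this form. The number of iterations to obtain a $\bar\varepsilon$-solution is the first $j$ for which $y_j$ is a $\bar\varepsilon$-solution. *)

theory Defs
  imports "HOL-Analysis.Analysis" "HOL-Library.Poly_Mapping"
begin

text \<open>
  The constant in the complexity bound must not depend on the dimension, so all spaces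
  \<open>\<real>\<^sup>n\<close> have to live in one type. That type is the space of finitely supported real sequences
  with the Euclidean inner product, and \<open>\<real>\<^sup>n\<close> is its subspace of the sequences that vanish
  from index \<open>n\<close> on.
\<close>

instantiation poly_mapping :: (type, real_vector) real_vector
begin

lift_definition scaleR_poly_mapping :: "real \<Rightarrow> ('a \<Rightarrow>\<^sub>0 'b) \<Rightarrow> ('a \<Rightarrow>\<^sub>0 'b)"
  is "\<lambda>r f k. r *\<^sub>R f k"
  by (rule finite_subset) auto

instance
  by standard (transfer; simp add: fun_eq_iff scaleR_add_left scaleR_add_right)+

end

instantiation poly_mapping :: (type, real_inner) real_inner
begin

definition inner_poly_mapping :: "('a \<Rightarrow>\<^sub>0 'b) \<Rightarrow> ('a \<Rightarrow>\<^sub>0 'b) \<Rightarrow> real"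
  where "inner_poly_mapping x y =
    (\<Sum>k \<in> Poly_Mapping.keys x \<union> Poly_Mapping.keys y.
      poly_mapping.lookup x k \<bullet> poly_mapping.lookup y k)"

definition norm_poly_mapping :: "('a \<Rightarrow>\<^sub>0 'b) \<Rightarrow> real"
  where "norm_poly_mapping x = sqrt (x \<bullet> x)"

definition dist_poly_mapping :: "('a \<Rightarrow>\<^sub>0 'b) \<Rightarrow> ('a \<Rightarrow>\<^sub>0 'b) \<Rightarrow> real"
  where "dist_poly_mapping x y = norm (x - y)"

definition sgn_poly_mapping :: "('a \<Rightarrow>\<^sub>0 'b) \<Rightarrow> ('a \<Rightarrow>\<^sub>0 'b)"
  where "sgn_poly_mapping x = x /\<^sub>R norm x"

definition uniformity_poly_mapping :: "(('a \<Rightarrow>\<^sub>0 'b) \<times> ('a \<Rightarrow>\<^sub>0 'b)) filter"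
  where "uniformity_poly_mapping = (INF e\<in>{0<..}. principal {(x, y). dist x y < e})"

definition open_poly_mapping :: "('a \<Rightarrow>\<^sub>0 'b) set \<Rightarrow> bool"
  where "open_poly_mapping U \<longleftrightarrow> (\<forall>x\<in>U. eventually (\<lambda>(x', y). x' = x \<longrightarrow> y \<in> U) uniformity)"

lemma inner_poly_mapping_eq_sum:
  fixes x y :: "'a \<Rightarrow>\<^sub>0 'b"
  assumes "finite K" "Poly_Mapping.keys x \<subseteq> K"
  shows "x \<bullet> y = (\<Sum>k\<in>K. poly_mapping.lookup x k \<bullet> poly_mapping.lookup y k)"
proof -
  let ?g = "\<lambda>k. poly_mapping.lookup x k \<bullet> poly_mapping.lookup y k"
  have "x \<bullet> y = sum ?g (Poly_Mapping.keys x)"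
    unfolding inner_poly_mapping_def
    by (rule sum.mono_neutral_right) (auto simp: in_keys_iff)
  also have "\<dots> = sum ?g K"
    using assms by (intro sum.mono_neutral_left) (auto simp: in_keys_iff)
  finally show ?thesis .
qed

instance
proof
  fix x y z :: "'a \<Rightarrow>\<^sub>0 'b" and r :: real
  show "x \<bullet> y = y \<bullet> x"
    by (simp add: inner_poly_mapping_def Un_commute inner_commute)
  let ?K = "Poly_Mapping.keys x \<union> Poly_Mapping.keys y"
  have "Poly_Mapping.keys (x + y) \<subseteq> ?K"
    by (rule keys_add)
  then have "(x + y) \<bullet> z = (\<Sum>k\<in>?K. poly_mapping.lookup (x + y) k \<bullet> poly_mapping.lookup z k)"
    by (intro inner_poly_mapping_eq_sum) simp_all
  moreover have "x \<bullet> z = (\<Sum>k\<in>?K. poly_mapping.lookup x k \<bullet> poly_mapping.lookup z k)"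
    by (intro inner_poly_mapping_eq_sum) simp_all
  moreover have "y \<bullet> z = (\<Sum>k\<in>?K. poly_mapping.lookup y k \<bullet> poly_mapping.lookup z k)"
    by (intro inner_poly_mapping_eq_sum) simp_all
  ultimately show "(x + y) \<bullet> z = x \<bullet> z + y \<bullet> z"
    by (simp add: lookup_add inner_add_left sum.distrib)
  have "Poly_Mapping.keys (r *\<^sub>R x) \<subseteq> Poly_Mapping.keys x"
    by (auto simp: in_keys_iff scaleR_poly_mapping.rep_eq)
  then have "(r *\<^sub>R x) \<bullet> y = (\<Sum>k\<in>Poly_Mapping.keys x. poly_mapping.lookup (r *\<^sub>R x) k \<bullet> poly_mapping.lookup y k)"
    by (intro inner_poly_mapping_eq_sum) simp_all
  moreover have "x \<bullet> y = (\<Sum>k\<in>Poly_Mapping.keys x. poly_mapping.lookup x k \<bullet> poly_mapping.lookup y k)"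
    by (intro inner_poly_mapping_eq_sum) simp_all
  ultimately show "(r *\<^sub>R x) \<bullet> y = r * (x \<bullet> y)"
    by (simp add: scaleR_poly_mapping.rep_eq sum_distrib_left)
  show "0 \<le> x \<bullet> x"
    by (auto simp: inner_poly_mapping_def intro: sum_nonneg)
  show "x \<bullet> x = 0 \<longleftrightarrow> x = 0"
    by (auto simp: inner_poly_mapping_def sum_nonneg_eq_0_iff in_keys_iff intro!: poly_mapping_eqI)
qed (simp_all add: norm_poly_mapping_def dist_poly_mapping_def sgn_poly_mapping_def
       uniformity_poly_mapping_def open_poly_mapping_def)

end

definition Rn :: "nat \<Rightarrow> (nat \<Rightarrow>\<^sub>0 real) set"
  where "Rn n = {x. Poly_Mapping.keys x \<subseteq> {..<n}}"

lemma inner_Rn: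
  "x \<in> Rn n \<Longrightarrow>
    x \<bullet> y = (\<Sum>i<n. poly_mapping.lookup x i * poly_mapping.lookup y i)"
  using inner_poly_mapping_eq_sum[of "{..<n}" x y] by (simp add: Rn_def)

text \<open>
  In what follows \<open>V\<close> is the underlying space (\<open>V = Rn n\<close> in the theorem), and a function
  \<open>V \<rightarrow> (-\<infinity>, +\<infinity>]\<close> is an \<open>ereal\<close>-valued function of which only the values on \<open>V\<close> matter.
\<close>

definition edom :: "'a set \<Rightarrow> ('a \<Rightarrow> ereal) \<Rightarrow> 'a set"
  where "edom V \<Psi> = {x\<in>V. \<Psi> x < \<infinity>}"

definition proper_on :: "'a set \<Rightarrow> ('a \<Rightarrow> ereal) \<Rightarrow> bool"
  where "proper_on V \<Psi> \<longleftrightarrow> (\<forall>x\<in>V. \<Psi> x \<noteq> -\<infinity>) \<and> edom V \<Psi> \<noteq> {}"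

definition lsc_on :: "'a::topological_space set \<Rightarrow> ('a \<Rightarrow> ereal) \<Rightarrow> bool"
  where "lsc_on V \<Psi> \<longleftrightarrow> (\<forall>x\<in>V. \<Psi> x \<le> Liminf (at x within V) \<Psi>)"

text \<open>
  The library's \<open>convex_on\<close> is for real-valued functions and includes convexity of the domain;
  an extended-valued function is convex iff it is \<open>convex_on\<close> its effective domain.
\<close>

definition Conv_bar :: "real \<Rightarrow> 'a::real_inner set \<Rightarrow> ('a \<Rightarrow> ereal) set"
  where "Conv_bar \<mu> V = {\<Psi>. proper_on V \<Psi> \<and> lsc_on V \<Psi> \<and>
    convex_on (edom V \<Psi>) (\<lambda>x. real_of_ereal (\<Psi> x) - \<mu> * (norm x)\<^sup>2 / 2)}"

definition subdiff :: "'a::real_inner set \<Rightarrow> ('a \<Rightarrow> ereal) \<Rightarrow> 'a \<Rightarrow> 'a set"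
  where "subdiff V f x = {v\<in>V. \<forall>u\<in>V. f x + ereal (v \<bullet> (u - x)) \<le> f u}"

definition linearization :: "('a::real_inner \<Rightarrow> ereal) \<Rightarrow> ('a \<Rightarrow> 'a) \<Rightarrow> 'a \<Rightarrow> 'a \<Rightarrow> ereal"
  where "linearization f f' x u = f x + ereal (f' x \<bullet> (u - x))"

definition assumption_A1 ::
  "'a::real_inner set \<Rightarrow> ('a \<Rightarrow> ereal) \<Rightarrow> ('a \<Rightarrow> 'a) \<Rightarrow> ('a \<Rightarrow> ereal) \<Rightarrow> real \<Rightarrow> bool"
  where "assumption_A1 V f f' h \<mu> \<longleftrightarrow>
    f \<in> Conv_bar 0 V \<and> h \<in> Conv_bar \<mu> V \<and> edom V h \<subseteq> edom V f \<and>
    (\<forall>x\<in>edom V h. f' x \<in> subdiff V f x)"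

definition objective :: "('a \<Rightarrow> ereal) \<Rightarrow> ('a \<Rightarrow> ereal) \<Rightarrow> 'a \<Rightarrow> ereal"
  where "objective f h x = f x + h x"

definition opt_set :: "'a set \<Rightarrow> ('a \<Rightarrow> ereal) \<Rightarrow> ('a \<Rightarrow> ereal) \<Rightarrow> 'a set"
  where "opt_set V f h = {x. is_arg_min (objective f h) (\<lambda>u. u \<in> V) x}"

definition assumption_A2 :: "'a set \<Rightarrow> ('a \<Rightarrow> ereal) \<Rightarrow> ('a \<Rightarrow> ereal) \<Rightarrow> bool"
  where "assumption_A2 V f h \<longleftrightarrow> opt_set V f h \<noteq> {}"

definition assumption_A3 ::
  "'a::real_inner set \<Rightarrow> ('a \<Rightarrow> 'a) \<Rightarrow> ('a \<Rightarrow> ereal) \<Rightarrow> real \<Rightarrow> real \<Rightarrow> bool"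
  where "assumption_A3 V f' h M L \<longleftrightarrow>
    (\<forall>x\<in>edom V h. \<forall>y\<in>edom V h. norm (f' x - f' y) \<le> 2 * M + L * norm (x - y))"

definition eps_solution ::
  "'a set \<Rightarrow> ('a \<Rightarrow> ereal) \<Rightarrow> ('a \<Rightarrow> ereal) \<Rightarrow> real \<Rightarrow> 'a \<Rightarrow> bool"
  where "eps_solution V f h \<epsilon> z \<longleftrightarrow>
    z \<in> edom V h \<and> objective f h z - (INF u\<in>V. objective f h u) \<le> ereal \<epsilon>"

definition Omega :: "'a::real_inner set \<Rightarrow> ('a \<Rightarrow> 'a) \<Rightarrow> ('a \<Rightarrow> ereal) \<Rightarrow> (real \<times> real) set"
  where "Omega V f' h = {(M, L). 0 \<le> M \<and> 0 \<le> L \<and> assumption_A3 V f' h M L}"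

definition T_eps :: "real \<Rightarrow> real \<Rightarrow> real \<Rightarrow> real"
  where "T_eps \<epsilon> M L = sqrt (M\<^sup>2 + \<epsilon> * L)"

definition t_bar :: "real \<Rightarrow> real \<Rightarrow> real \<Rightarrow> real \<Rightarrow> real"
  where "t_bar M L lam d = M\<^sup>2 + 4 * (L + 2) * (max 1 (2 * lam * L) * d + lam * M)\<^sup>2"

definition log_plus :: "real \<Rightarrow> real"
  where "log_plus s = (if s = 0 then 0 else max 0 (ln s))"

definition gpb_input ::
  "'a set \<Rightarrow> ('a \<Rightarrow> ereal) \<Rightarrow> real \<Rightarrow> real \<Rightarrow> 'a \<Rightarrow> real \<Rightarrow> real \<Rightarrow> real \<Rightarrow> bool"
  where "gpb_input V h \<mu> T x0 lam \<epsilon> \<tau> \<longleftrightarrow>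
    x0 \<in> edom V h \<and> 0 < lam \<and> 0 < \<epsilon> \<and> 0 < \<tau> \<and> \<tau> < 1 \<and>
    8 * lam * T\<^sup>2 / ((1 + lam * \<mu>) * \<epsilon>) \<le> \<tau> / (1 - \<tau>)"

definition prox_objective :: "real \<Rightarrow> 'a::real_inner \<Rightarrow> ('a \<Rightarrow> ereal) \<Rightarrow> 'a \<Rightarrow> ereal"
  where "prox_objective lam c G u = G u + ereal ((norm (u - c))\<^sup>2 / (2 * lam))"

definition gpb_gap ::
  "('a::real_inner \<Rightarrow> ereal) \<Rightarrow> real \<Rightarrow> (nat \<Rightarrow> 'a \<Rightarrow> ereal) \<Rightarrow> (nat \<Rightarrow> 'a) \<Rightarrow> (nat \<Rightarrow> 'a) \<Rightarrow>
    (nat \<Rightarrow> 'a) \<Rightarrow> nat \<Rightarrow> ereal"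
  where "gpb_gap \<phi> lam \<Gamma> xc x y j =
    (if j = 0 then 0 else \<phi> (y j) - prox_objective lam (xc j) (\<Gamma> j) (x j))"

text \<open>
  The sequences \<open>\<Gamma>\<close>, \<open>xc\<close>, \<open>x\<close>, \<open>y\<close> form a (non-terminating) run of the framework. The values
  \<open>\<Gamma> 0\<close> and \<open>xc 0\<close> are irrelevant, because the first iteration is always a serious update.
\<close>

definition gpb_run ::
  "'a::real_inner set \<Rightarrow> ('a \<Rightarrow> ereal) \<Rightarrow> ('a \<Rightarrow> 'a) \<Rightarrow> ('a \<Rightarrow> ereal) \<Rightarrow> real \<Rightarrow>
    'a \<Rightarrow> real \<Rightarrow> real \<Rightarrow> real \<Rightarrow>
    (nat \<Rightarrow> 'a \<Rightarrow> ereal) \<Rightarrow> (nat \<Rightarrow> 'a) \<Rightarrow> (nat \<Rightarrow> 'a) \<Rightarrow> (nat \<Rightarrow> 'a) \<Rightarrow> bool"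
  where "gpb_run V f f' h \<mu> x0 lam \<epsilon> \<tau> \<Gamma> xc x y \<longleftrightarrow>
    x 0 = x0 \<and> y 0 = x0 \<and>
    (\<forall>j\<ge>1.
      \<comment> \<open>Step 1\<close>
      (if gpb_gap (objective f h) lam \<Gamma> xc x y (j - 1) \<le> ereal (\<epsilon> / 2)
       then xc j = x (j - 1) \<and>
         (\<forall>u\<in>V. linearization f f' (x (j - 1)) u + h u \<le> \<Gamma> j u)
       else xc j = xc (j - 1) \<and>
         (\<exists>G\<in>Conv_bar \<mu> V.
           G (x (j - 1)) = \<Gamma> (j - 1) (x (j - 1)) \<and>
           is_arg_min (prox_objective lam (xc (j - 1)) G) (\<lambda>u. u \<in> V) (x (j - 1)) \<and>
           (\<forall>u\<in>V. ereal \<tau> * G u + ereal (1 - \<tau>) * (linearization f f' (x (j - 1)) u + h u)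
             \<le> \<Gamma> j u))) \<and>
      \<Gamma> j \<in> Conv_bar \<mu> V \<and>
      (\<forall>u\<in>V. \<Gamma> j u \<le> objective f h u) \<and>
      \<comment> \<open>Step 2\<close>
      is_arg_min (prox_objective lam (xc j) (\<Gamma> j)) (\<lambda>u. u \<in> V) (x j) \<and>
      is_arg_min (objective f h) (\<lambda>u. u \<in> x ` {0..j}) (y j))"

text \<open>
  The expression inside the big O, with \<open>K = M\<^sub>f\<^sup>2 + \<epsilon> L\<^sub>f\<close>; the case \<open>\<mu> = 0\<close> is the convention
  that the second term of the minimum then equals the first.
\<close>

definition gpb_bound :: "real \<Rightarrow> real \<Rightarrow> real \<Rightarrow> real \<Rightarrow> real"
  where "gpb_bound K \<epsilon> \<mu> d =
    (let b1 = K * d\<^sup>2 / \<epsilon>\<^sup>2;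
         b2 = (if \<mu> = 0 then b1
               else (K / (\<mu> * \<epsilon>) + 1) * ln (\<mu> * d\<^sup>2 / \<epsilon> + 1))
     in min b1 b2 + 1)"

end

theory Submission
  imports Defs
begin

text \<open>
  Group the iterations into cycles: a serious update and the null updates that follow it. All
  iterations of a cycle are proximal steps from the same center, and the proof bounds the number
  of cycles and the length of a cycle separately. Write \<open>a = 1 + lam \<mu>\<close>.

  Number of cycles. At the end of a cycle the gap is at most \<open>\<epsilon> / 2\<close>. Since the models lie below
  the objective and the proximal objective grows quadratically around its minimizer
  (\<open>prox_argmin_growth\<close>), the distance \<open>d\<close> from the center to the solution then drops to some
  \<open>d'\<close> with \<open>a d'\<^sup>2 + lam \<epsilon> \<le> d\<^sup>2\<close>, unless an \<open>\<epsilon>\<close>-solution has been found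
  (\<open>serious_distance\<close>). Hence \<open>k\<close> unsuccessful cycles force
  \<open>lam \<epsilon> (1 + a + \<dots> + a ^ (k - 1)) \<le> d\<^sub>0\<^sup>2\<close>, which bounds \<open>k\<close> by \<open>d\<^sub>0\<^sup>2 / (lam \<epsilon>)\<close> and, for
  positive \<open>\<mu>\<close>, by \<open>a / (lam \<mu>) ln (1 + \<mu> d\<^sub>0\<^sup>2 / \<epsilon>)\<close>.

  Length of a cycle. A null update shrinks the excess of the gap over \<open>\<epsilon> / 4\<close> at least by the
  factor \<open>\<tau>\<close>   (\<open>null_gap\<close>), and the first gap of a cycle is at most a constant times \<open>t_bar\<close>
  (\<open>serious_gap\<close>). So the gap is at most \<open>\<epsilon> / 2\<close> after about \<open>log_plus (4 t_bar / \<epsilon>) / (1 - \<tau>)\<close>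
  updates, where \<open>1 / (1 - \<tau>) = 1 + 8 lam K / (a \<epsilon>)\<close> with \<open>K = M\<^sub>f\<^sup>2 + \<epsilon> L\<^sub>f\<close>.

  The product of the two bounds is the claim, once the conditions on \<open>lam\<close> are used to absorb
  the lower-order terms (\<open>cycles_times_length_le_bound\<close>).
\<close>

section \<open>Strong convexity\<close>

lemma norm_convex_combination:
  fixes x u :: "'a::real_inner"
  shows "(norm ((1 - t) *\<^sub>R x + t *\<^sub>R u))\<^sup>2 =
    (1 - t) * (norm x)\<^sup>2 + t * (norm u)\<^sup>2 - t * (1 - t) * (norm (u - x))\<^sup>2"
  by (simp add: power2_norm_eq_inner inner_add_left inner_add_right inner_diff_left
      inner_diff_right inner_commute[of u x] algebra_simps)

lemma edom_finite:
  assumes "\<Psi> \<in> Conv_bar \<mu> V" "x \<in> edom V \<Psi>"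
  shows "\<Psi> x = ereal (real_of_ereal (\<Psi> x))"
proof -
  have "\<Psi> x \<noteq> \<infinity>" "\<Psi> x \<noteq> -\<infinity>"
    using assms by (auto simp: Conv_bar_def proper_on_def edom_def)
  then show ?thesis
    by (cases "\<Psi> x") auto
qed

lemma Conv_bar_convex_combination:
  assumes \<Psi>: "\<Psi> \<in> Conv_bar \<mu> V" and x: "x \<in> edom V \<Psi>" and u: "u \<in> edom V \<Psi>"
    and t: "0 \<le> t" "t \<le> 1"
  shows "(1 - t) *\<^sub>R x + t *\<^sub>R u \<in> edom V \<Psi>"
    and "real_of_ereal (\<Psi> ((1 - t) *\<^sub>R x + t *\<^sub>R u)) \<le>
      (1 - t) * real_of_ereal (\<Psi> x) + t * real_of_ereal (\<Psi> u)
      - \<mu> / 2 * (t * (1 - t) * (norm (u - x))\<^sup>2)"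
proof -
  let ?g = "\<lambda>x. real_of_ereal (\<Psi> x) - \<mu> * (norm x)\<^sup>2 / 2"
  have c: "convex_on (edom V \<Psi>) ?g"
    using \<Psi> by (simp add: Conv_bar_def)
  show "(1 - t) *\<^sub>R x + t *\<^sub>R u \<in> edom V \<Psi>"
    using convex_on_imp_convex[OF c] x u t by (simp add: convex_def)
  have "?g ((1 - t) *\<^sub>R x + t *\<^sub>R u) \<le> (1 - t) * ?g x + t * ?g u"
    using convex_onD[OF c t x u] .
  then show "real_of_ereal (\<Psi> ((1 - t) *\<^sub>R x + t *\<^sub>R u)) \<le>
      (1 - t) * real_of_ereal (\<Psi> x) + t * real_of_ereal (\<Psi> u)
      - \<mu> / 2 * (t * (1 - t) * (norm (u - x))\<^sup>2)"
    unfolding norm_convex_combination by (simp add: algebra_simps add_divide_distrib diff_divide_distrib)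
qed

text \<open>
  The proximal objective is \<open>(\<mu> + 1 / lam)\<close>-strongly convex, so it grows quadratically away from
  its minimizer: compare the minimizer \<open>x\<close> with the points \<open>x + t (u - x)\<close> and let \<open>t\<close> tend to 0.
\<close>

lemma prox_argmin_growth:
  assumes \<Psi>: "\<Psi> \<in> Conv_bar \<mu> V" and lam: "0 < lam"
    and min: "is_arg_min (prox_objective lam c \<Psi>) (\<lambda>u. u \<in> V) x" and u: "u \<in> edom V \<Psi>"
  shows "x \<in> edom V \<Psi>"
    and "real_of_ereal (\<Psi> x) + (norm (x - c))\<^sup>2 / (2 * lam)
        + (1 + lam * \<mu>) * (norm (u - x))\<^sup>2 / (2 * lam)
      \<le> real_of_ereal (\<Psi> u) + (norm (u - c))\<^sup>2 / (2 * lam)"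
proof -
  have le: "prox_objective lam c \<Psi> x \<le> prox_objective lam c \<Psi> w" if "w \<in> V" for w
    using min that by (auto simp: is_arg_min_def not_less)
  have xV: "x \<in> V" and uV: "u \<in> V"
    using min u by (auto simp: is_arg_min_def edom_def)
  have "prox_objective lam c \<Psi> x < \<infinity>"
    using le[OF uV] edom_finite[OF \<Psi> u] unfolding prox_objective_def
    by (metis ereal_infty_less_eq(1) less_ereal.simps(4) linorder_not_less plus_ereal.simps(1)
        order_le_less_trans)
  then show x: "x \<in> edom V \<Psi>"
    using xV by (auto simp: prox_objective_def edom_def)
  define P where "P w = real_of_ereal (\<Psi> w) + (norm (w - c))\<^sup>2 / (2 * lam)" for w
  define q where "q = (1 + lam * \<mu>) * (norm (u - x))\<^sup>2 / (2 * lam)"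
  have P: "prox_objective lam c \<Psi> w = ereal (P w)" if "w \<in> edom V \<Psi>" for w
    using edom_finite[OF \<Psi> that] by (metis P_def plus_ereal.simps(1) prox_objective_def)
  (* dividing by t the comparison with the point at parameter t *)
  have step: "P x \<le> P u - (1 - t) * q" if t: "0 < t" "t < 1" for t
  proof -
    let ?w = "(1 - t) *\<^sub>R x + t *\<^sub>R u"
    have w: "?w \<in> edom V \<Psi>"
      and \<Psi>w: "real_of_ereal (\<Psi> ?w) \<le> (1 - t) * real_of_ereal (\<Psi> x) + t * real_of_ereal (\<Psi> u)
      - \<mu> / 2 * (t * (1 - t) * (norm (u - x))\<^sup>2)"
      using Conv_bar_convex_combination[OF \<Psi> x u, of t] t by auto
    have "?w - c = (1 - t) *\<^sub>R (x - c) + t *\<^sub>R (u - c)"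
      by (simp add: algebra_simps)
    then have nw: "(norm (?w - c))\<^sup>2 = (1 - t) * (norm (x - c))\<^sup>2 + t * (norm (u - c))\<^sup>2
        - t * (1 - t) * (norm (u - x))\<^sup>2"
      using norm_convex_combination[of t "x - c" "u - c"] by simp
    have "P x \<le> P ?w"
      using le[of ?w] w P[OF x] P[OF w] by (simp add: edom_def)
    also have "P ?w \<le> (1 - t) * P x + t * P u - t * (1 - t) * q"
    proof -
      define i where "i = 1 / (2 * lam)"
      have i: "z / (2 * lam) = z * i" for z
        by (simp add: i_def)
      have "lam * i = 1 / 2"
        using lam by (simp add: i_def)
      then have "q = (norm (u - x))\<^sup>2 * i + \<mu> / 2 * (norm (u - x))\<^sup>2"
        unfolding q_def i by (simp add: ring_distribs mult_ac)
      then show ?thesis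
        using \<Psi>w unfolding P_def nw i by (simp add: algebra_simps diff_divide_distrib)
    qed
    finally have "t * P x \<le> t * (P u - (1 - t) * q)"
      by (simp add: algebra_simps)
    then show ?thesis
      using t by simp
  qed
  have "((\<lambda>t. P u - (1 - t) * q) \<longlongrightarrow> P u - (1 - 0) * q) (at_right 0)"
    by (intro tendsto_intros)
  moreover have "\<forall>\<^sub>F t in at_right (0::real). P x \<le> P u - (1 - t) * q"
    using step by (auto simp: eventually_at_right_field intro: exI[of _ 1])
  ultimately have "P x \<le> P u - (1 - 0) * q"
    by (intro tendsto_lowerbound[of _ _ "at_right 0"]) auto
  then show "real_of_ereal (\<Psi> x) + (norm (x - c))\<^sup>2 / (2 * lam)
        + (1 + lam * \<mu>) * (norm (u - x))\<^sup>2 / (2 * lam)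
      \<le> real_of_ereal (\<Psi> u) + (norm (u - c))\<^sup>2 / (2 * lam)"
    by (simp add: P_def q_def)
qed

section \<open>The iterates of a run\<close>

text \<open>
  In the theorem, \<open>(M, L)\<close> is the minimizing pair of constants, while \<open>\<tau>\<close> is computed from another
  pair. The link between the two is the inequality for \<open>\<tau>\<close> in \<open>input\<close>.
\<close>

locale gpb_iteration =
  fixes V :: "'a::real_inner set" and f :: "'a \<Rightarrow> ereal" and f' :: "'a \<Rightarrow> 'a" and h :: "'a \<Rightarrow> ereal"
    and \<mu> M L \<epsilon> lam \<tau> :: real and x0 xs :: 'a
    and \<Gamma> :: "nat \<Rightarrow> 'a \<Rightarrow> ereal" and xc x y :: "nat \<Rightarrow> 'a"
  assumes A1: "assumption_A1 V f f' h \<mu>" and A3: "assumption_A3 V f' h M L"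
    and xs: "xs \<in> opt_set V f h"
    and nonneg: "0 \<le> \<mu>" "0 \<le> M" "0 \<le> L"
    and input: "gpb_input V h \<mu> (T_eps \<epsilon> M L) x0 lam \<epsilon> \<tau>"
    and run: "gpb_run V f f' h \<mu> x0 lam \<epsilon> \<tau> \<Gamma> xc x y"
begin

abbreviation "D \<equiv> edom V h"

definition fr :: "'a \<Rightarrow> real" where "fr u = real_of_ereal (f u)"
definition hr :: "'a \<Rightarrow> real" where "hr u = real_of_ereal (h u)"
definition \<phi> :: "'a \<Rightarrow> real" where "\<phi> u = fr u + hr u"

definition m :: "nat \<Rightarrow> real"
  where "m j = real_of_ereal (\<Gamma> j (x j)) + (norm (x j - xc j))\<^sup>2 / (2 * lam)"

text \<open>The convention \<open>t 0 = 0\<close> makes the first iteration a serious update.\<close>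

definition t :: "nat \<Rightarrow> real"
  where "t j = (if j = 0 then 0 else \<phi> (y j) - m j)"

lemma f_Conv: "f \<in> Conv_bar 0 V" and h_Conv: "h \<in> Conv_bar \<mu> V" and D_sub: "D \<subseteq> edom V f"
  and f'_sub: "u \<in> D \<Longrightarrow> f' u \<in> subdiff V f u"
  using A1 by (auto simp: assumption_A1_def)

lemma pos: "0 < lam" "0 < \<epsilon>" "0 < \<tau>" "\<tau> < 1" "x0 \<in> D"
  using input by (auto simp: gpb_input_def)

lemma D_V: "u \<in> D \<Longrightarrow> u \<in> V"
  by (simp add: edom_def)

lemma f_eq: "u \<in> D \<Longrightarrow> f u = ereal (fr u)"
  using edom_finite[OF f_Conv] D_sub by (auto simp: fr_def)

lemma h_eq: "u \<in> D \<Longrightarrow> h u = ereal (hr u)"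
  using edom_finite[OF h_Conv] by (auto simp: hr_def)

lemma objective_eq: "u \<in> D \<Longrightarrow> objective f h u = ereal (\<phi> u)"
  by (simp add: objective_def f_eq h_eq \<phi>_def)

lemma linearization_eq:
  "v \<in> D \<Longrightarrow> u \<in> D \<Longrightarrow>
    linearization f f' v u + h u = ereal (fr v + f' v \<bullet> (u - v) + hr u)"
  by (simp add: linearization_def f_eq h_eq)

lemma linearization_infty:
  assumes "v \<in> D" "u \<in> V" "u \<notin> D"
  shows "linearization f f' v u + h u = \<infinity>"
proof -
  have "h u = \<infinity>"
    using assms by (auto simp: edom_def)
  then show ?thesis
    by (simp add: linearization_def f_eq[OF assms(1)])
qed

lemma xs_le: "u \<in> V \<Longrightarrow> objective f h xs \<le> objective f h u"
  using xs by (auto simp: opt_set_def is_arg_min_def not_less)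

lemma xs_D: "xs \<in> D"
proof -
  have V: "xs \<in> V"
    using xs by (simp add: opt_set_def is_arg_min_def)
  have "f xs \<noteq> -\<infinity>"
    using f_Conv V by (auto simp: Conv_bar_def proper_on_def)
  moreover have "objective f h xs \<noteq> \<infinity>"
    using xs_le[OF D_V[OF pos(5)]] objective_eq[OF pos(5)] by auto
  ultimately have "h xs \<noteq> \<infinity>"
    by (auto simp: objective_def)
  then show ?thesis
    using V by (auto simp: edom_def)
qed

lemma \<phi>_xs_le: "u \<in> D \<Longrightarrow> \<phi> xs \<le> \<phi> u"
  using xs_le[of u] objective_eq[of u] objective_eq[OF xs_D] D_V by simp

lemma eps_solution_iff:
  assumes "u \<in> D"
  shows "eps_solution V f h \<epsilon> u \<longleftrightarrow> \<phi> u - \<phi> xs \<le> \<epsilon>"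
proof -
  have "(INF u\<in>V. objective f h u) = objective f h xs"
    using xs_le xs_D D_V by (intro antisym INF_greatest INF_lower) auto
  then show ?thesis
    using assms by (simp add: eps_solution_def objective_eq xs_D)
qed

lemma linearization_le: "v \<in> D \<Longrightarrow> u \<in> D \<Longrightarrow> fr v + f' v \<bullet> (u - v) \<le> fr u"
  using f'_sub[of v] D_V[of u] by (auto simp: subdiff_def f_eq)

text \<open>
  The subgradient inequality at \<open>u\<close>, evaluated at \<open>v\<close>, bounds the error by
  \<open>(f' u - f' v) \<bullet> (u - v)\<close>.
\<close>

lemma linearization_error:
  assumes "v \<in> D" "u \<in> D"
  shows "fr u - (fr v + f' v \<bullet> (u - v)) \<le> 2 * M * norm (u - v) + L * (norm (u - v))\<^sup>2"
proof -
  have "fr u + f' u \<bullet> (v - u) \<le> fr v"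
    by (rule linearization_le[OF assms(2,1)])
  then have "fr u - (fr v + f' v \<bullet> (u - v)) \<le> (f' u - f' v) \<bullet> (u - v)"
    by (simp add: inner_diff_left inner_diff_right)
  also have "\<dots> \<le> norm (f' u - f' v) * norm (u - v)"
    by (rule norm_cauchy_schwarz)
  also have "\<dots> \<le> (2 * M + L * norm (u - v)) * norm (u - v)"
    using A3 assms by (intro mult_right_mono) (auto simp: assumption_A3_def)
  finally show ?thesis
    by (simp add: algebra_simps power2_eq_square)
qed

lemma x_0: "x 0 = x0" and y_0: "y 0 = x0"
  using run by (auto simp: gpb_run_def)

lemma run_step:
  assumes "j \<ge> 1"
  shows "\<Gamma> j \<in> Conv_bar \<mu> V" "u \<in> V \<Longrightarrow> \<Gamma> j u \<le> objective f h u"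
    "is_arg_min (prox_objective lam (xc j) (\<Gamma> j)) (\<lambda>u. u \<in> V) (x j)"
    "is_arg_min (objective f h) (\<lambda>u. u \<in> x ` {0..j}) (y j)"
  using run assms unfolding gpb_run_def by blast+

lemma run_serious:
  assumes "gpb_gap (objective f h) lam \<Gamma> xc x y j \<le> ereal (\<epsilon> / 2)"
  shows "xc (Suc j) = x j" "u \<in> V \<Longrightarrow> linearization f f' (x j) u + h u \<le> \<Gamma> (Suc j) u"
  using run assms unfolding gpb_run_def by (auto dest!: spec[of _ "Suc j"])

lemma run_null:
  assumes "\<not> gpb_gap (objective f h) lam \<Gamma> xc x y j \<le> ereal (\<epsilon> / 2)"
  obtains G where "xc (Suc j) = xc j" "G \<in> Conv_bar \<mu> V" "G (x j) = \<Gamma> j (x j)"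
    "is_arg_min (prox_objective lam (xc j) G) (\<lambda>u. u \<in> V) (x j)"
    "\<And>u. u \<in> V \<Longrightarrow>
      ereal \<tau> * G u + ereal (1 - \<tau>) * (linearization f f' (x j) u + h u) \<le> \<Gamma> (Suc j) u"
  using run assms unfolding gpb_run_def by (auto dest!: spec[of _ "Suc j"])

lemma D_edom_\<Gamma>:
  assumes "j \<ge> 1" "u \<in> D"
  shows "u \<in> edom V (\<Gamma> j)" "real_of_ereal (\<Gamma> j u) \<le> \<phi> u"
proof -
  have le: "\<Gamma> j u \<le> ereal (\<phi> u)"
    using run_step(2)[OF assms(1) D_V[OF assms(2)]] objective_eq[OF assms(2)] by simp
  then show e: "u \<in> edom V (\<Gamma> j)"
    using D_V[OF assms(2)] by (auto simp: edom_def)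
  show "real_of_ereal (\<Gamma> j u) \<le> \<phi> u"
    using le edom_finite[OF run_step(1)[OF assms(1)] e] by (metis ereal_less_eq(3))
qed

lemma x_edom_\<Gamma>: "j \<ge> 1 \<Longrightarrow> x j \<in> edom V (\<Gamma> j)"
  using prox_argmin_growth(1)[OF run_step(1) pos(1) run_step(3) D_edom_\<Gamma>(1)[OF _ xs_D]] .

text \<open>
  The model is finite at \<open>x j\<close> and dominates a positive multiple of \<open>h\<close> plus something bigger
  than \<open>-\<infinity>\<close>, so \<open>h\<close> is finite there as well.
\<close>

lemma x_D: "x j \<in> D"
proof (induction j)
  case 0
  then show ?case
    using pos(5) x_0 by simp
next
  case (Suc j)
  have e: "x (Suc j) \<in> edom V (\<Gamma> (Suc j))"
    by (rule x_edom_\<Gamma>) simp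
  then have V: "x (Suc j) \<in> V" and fin: "\<Gamma> (Suc j) (x (Suc j)) < \<infinity>"
    by (auto simp: edom_def)
  show ?case
  proof (rule ccontr)
    assume "x (Suc j) \<notin> D"
    then have inf: "linearization f f' (x j) (x (Suc j)) + h (x (Suc j)) = \<infinity>"
      using linearization_infty Suc V by blast
    show False
    proof (cases "gpb_gap (objective f h) lam \<Gamma> xc x y j \<le> ereal (\<epsilon> / 2)")
      case True
      then show ?thesis
        using run_serious(2)[OF True V] inf fin by simp
    next
      case False
      obtain G where G: "G \<in> Conv_bar \<mu> V"
        and le: "\<And>u. u \<in> V \<Longrightarrow>
          ereal \<tau> * G u + ereal (1 - \<tau>) * (linearization f f' (x j) u + h u) \<le> \<Gamma> (Suc j) u"
        using run_null[OF False] by metis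
      have "G (x (Suc j)) \<noteq> -\<infinity>"
        using G V by (auto simp: Conv_bar_def proper_on_def)
      then have "ereal \<tau> * G (x (Suc j)) \<noteq> -\<infinity>"
        using pos by (cases "G (x (Suc j))") auto
      then show ?thesis
        using le[OF V] inf fin pos by simp
    qed
  qed
qed

lemma y_D: "y j \<in> D" and y_le: "i \<le> j \<Longrightarrow> \<phi> (y j) \<le> \<phi> (x i)"
proof -
  have *: "y j \<in> x ` {0..j} \<and> (\<forall>i\<le>j. objective f h (y j) \<le> objective f h (x i))"
  proof (cases "j = 0")
    case True
    then show ?thesis
      by (simp add: x_0 y_0)
  next
    case False
    then show ?thesis
      using run_step(4)[of j] by (auto simp: is_arg_min_def not_less)
  qed
  then show y: "y j \<in> D"
    using x_D by auto
  show "i \<le> j \<Longrightarrow> \<phi> (y j) \<le> \<phi> (x i)"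
    using * objective_eq[OF y] objective_eq[OF x_D] by simp
qed

lemma \<Gamma>_x_eq: "j \<ge> 1 \<Longrightarrow> \<Gamma> j (x j) = ereal (real_of_ereal (\<Gamma> j (x j)))"
  by (rule edom_finite[OF run_step(1) x_edom_\<Gamma>])

lemma gap_eq: "gpb_gap (objective f h) lam \<Gamma> xc x y j = ereal (t j)"
proof (cases "j = 0")
  case True
  then show ?thesis
    by (simp add: gpb_gap_def t_def zero_ereal_def)
next
  case False
  then have "prox_objective lam (xc j) (\<Gamma> j) (x j) = ereal (m j)"
    unfolding prox_objective_def m_def using \<Gamma>_x_eq[of j] by (metis Suc_leI One_nat_def neq0_conv plus_ereal.simps(1))
  then show ?thesis
    using False by (simp add: gpb_gap_def t_def objective_eq y_D)
qed

lemma m_growth: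
  assumes "j \<ge> 1"
  shows "m j + (1 + lam * \<mu>) * (norm (xs - x j))\<^sup>2 / (2 * lam)
    \<le> \<phi> xs + (norm (xs - xc j))\<^sup>2 / (2 * lam)"
  using prox_argmin_growth(2)[OF run_step(1)[OF assms] pos(1) run_step(3)[OF assms]
      D_edom_\<Gamma>(1)[OF assms xs_D]] D_edom_\<Gamma>(2)[OF assms xs_D]
  by (simp add: m_def)

section \<open>Null and serious updates\<close>

text \<open>
  A null update contracts the gap towards \<open>\<epsilon> / 4\<close>. The new model is at least \<open>\<tau>\<close> times the old
  one, which grows quadratically around \<open>x j\<close>, plus \<open>1 - \<tau>\<close> times the linearization at \<open>x j\<close>,
  whose error is \<open>2 M r + L r\<^sup>2\<close>. The condition on \<open>\<tau>\<close> makes the growth large enough to absorb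
  this error up to \<open>\<epsilon> / 4\<close>, because \<open>2 M r \<le> 4 M\<^sup>2 r\<^sup>2 / \<epsilon> + \<epsilon> / 4\<close>.
\<close>

lemma null_gap:
  assumes null: "\<not> t j \<le> \<epsilon> / 2"
  shows "xc (Suc j) = xc j" and "t (Suc j) - \<epsilon> / 4 \<le> \<tau> * (t j - \<epsilon> / 4)"
proof -
  have j: "j \<ge> 1"
    using null pos by (cases j) (auto simp: t_def)
  have gap: "\<not> gpb_gap (objective f h) lam \<Gamma> xc x y j \<le> ereal (\<epsilon> / 2)"
    using null by (simp add: gap_eq)
  obtain G where c: "xc (Suc j) = xc j" and G: "G \<in> Conv_bar \<mu> V" and Gx: "G (x j) = \<Gamma> j (x j)"
    and min: "is_arg_min (prox_objective lam (xc j) G) (\<lambda>u. u \<in> V) (x j)"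
    and le: "\<And>u. u \<in> V \<Longrightarrow>
      ereal \<tau> * G u + ereal (1 - \<tau>) * (linearization f f' (x j) u + h u) \<le> \<Gamma> (Suc j) u"
    using run_null[OF gap] by metis
  show "xc (Suc j) = xc j"
    by (rule c)
  let ?u = "x (Suc j)"
  let ?g = "real_of_ereal (\<Gamma> (Suc j) ?u)"
  define l where "l = fr (x j) + f' (x j) \<bullet> (?u - x j)"
  define r where "r = norm (?u - x j)"
  have uV: "?u \<in> V"
    using x_D D_V by blast
  have le': "ereal \<tau> * G ?u + ereal ((1 - \<tau>) * (l + hr ?u)) \<le> ereal ?g"
    using le[OF uV] linearization_eq[OF x_D x_D, of j "Suc j"] \<Gamma>_x_eq[of "Suc j"]
    by (simp add: l_def)
  have "G ?u \<noteq> \<infinity>"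
    using le' pos by auto
  then have u: "?u \<in> edom V G"
    using uV by (auto simp: edom_def)
  define Gu where "Gu = real_of_ereal (G ?u)"
  have "G ?u = ereal Gu"
    using edom_finite[OF G u] by (simp add: Gu_def)
  then have lower: "\<tau> * Gu + (1 - \<tau>) * (l + hr ?u) \<le> ?g"
    using le' by simp
  have growth: "m j + (1 + lam * \<mu>) * r\<^sup>2 / (2 * lam) \<le> Gu + (norm (?u - xc j))\<^sup>2 / (2 * lam)"
    using prox_argmin_growth(2)[OF G pos(1) min u] by (simp add: m_def Gx Gu_def r_def)
  have err: "fr ?u - l \<le> 2 * M * r + L * r\<^sup>2"
    using linearization_error[OF x_D x_D] by (simp add: l_def r_def)
  have young: "2 * M * r + L * r\<^sup>2 \<le> 4 * (M\<^sup>2 + \<epsilon> * L) / \<epsilon> * r\<^sup>2 + \<epsilon> / 4"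
  proof -
    have "0 \<le> (2 * M * r - \<epsilon> / 2)\<^sup>2 / \<epsilon>"
      using pos by simp
    also have "\<dots> = 4 * M\<^sup>2 / \<epsilon> * r\<^sup>2 + \<epsilon> / 4 - 2 * M * r"
      using pos by (simp add: power2_eq_square field_simps)
    finally have "2 * M * r \<le> 4 * M\<^sup>2 / \<epsilon> * r\<^sup>2 + \<epsilon> / 4"
      by simp
    moreover have "4 * (M\<^sup>2 + \<epsilon> * L) / \<epsilon> * r\<^sup>2 = 4 * M\<^sup>2 / \<epsilon> * r\<^sup>2 + 4 * (L * r\<^sup>2)"
      using pos by (simp add: field_simps)
    moreover have "0 \<le> L * r\<^sup>2"
      using nonneg by simp
    ultimately show ?thesis
      by linarith
  qed
  have a: "0 < 1 + lam * \<mu>"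
    using pos nonneg by (simp add: add_pos_nonneg)
  have "(T_eps \<epsilon> M L)\<^sup>2 = M\<^sup>2 + \<epsilon> * L"
    using nonneg pos by (simp add: T_eps_def)
  then have "8 * lam * (M\<^sup>2 + \<epsilon> * L) / ((1 + lam * \<mu>) * \<epsilon>) \<le> \<tau> / (1 - \<tau>)"
    using input by (simp add: gpb_input_def)
  then have "8 * lam * (M\<^sup>2 + \<epsilon> * L) * (1 - \<tau>) \<le> \<tau> * ((1 + lam * \<mu>) * \<epsilon>)"
    using pos a by (simp add: divide_le_eq pos_le_divide_eq mult.commute mult.left_commute)
  then have "(1 - \<tau>) * (4 * (M\<^sup>2 + \<epsilon> * L) / \<epsilon>) \<le> \<tau> * ((1 + lam * \<mu>) / (2 * lam))"
    using pos by (simp add: field_simps)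
  then have "(1 - \<tau>) * (4 * (M\<^sup>2 + \<epsilon> * L) / \<epsilon>) * r\<^sup>2 \<le> \<tau> * ((1 + lam * \<mu>) / (2 * lam)) * r\<^sup>2"
    by (rule mult_right_mono) simp
  moreover have "(1 - \<tau>) * (fr ?u - l) \<le> (1 - \<tau>) * (4 * (M\<^sup>2 + \<epsilon> * L) / \<epsilon> * r\<^sup>2 + \<epsilon> / 4)"
    using err young pos by (intro mult_left_mono) auto
  ultimately have absorb:
    "(1 - \<tau>) * (fr ?u - l) \<le> \<tau> * ((1 + lam * \<mu>) * r\<^sup>2 / (2 * lam)) + (1 - \<tau>) * (\<epsilon> / 4)"
    by (simp add: algebra_simps)
  define s where "s = (norm (?u - xc j))\<^sup>2 / (2 * lam)"
  have s: "0 \<le> s"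
    using pos by (simp add: s_def)
  have "\<tau> * (m j + (1 + lam * \<mu>) * r\<^sup>2 / (2 * lam)) \<le> \<tau> * (Gu + s)"
    using growth pos by (intro mult_left_mono) (auto simp: s_def)
  moreover have "m (Suc j) = ?g + s"
    by (simp add: m_def s_def c)
  ultimately have "\<tau> * m j + \<tau> * ((1 + lam * \<mu>) * r\<^sup>2 / (2 * lam)) + (1 - \<tau>) * (l + hr ?u)
      \<le> m (Suc j) - (1 - \<tau>) * s"
    using lower by (simp add: algebra_simps)
  moreover have "0 \<le> (1 - \<tau>) * s"
    using s pos by simp
  ultimately have *: "\<tau> * m j + (1 - \<tau>) * \<phi> ?u - (1 - \<tau>) * (\<epsilon> / 4) \<le> m (Suc j)"
    using absorb by (simp add: \<phi>_def algebra_simps)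
  have "\<tau> * \<phi> (y (Suc j)) \<le> \<tau> * \<phi> (y j)"
  proof -
    have "y j \<in> x ` {0..j}"
      using run_step(4)[OF j] by (simp add: is_arg_min_def)
    then have "\<phi> (y (Suc j)) \<le> \<phi> (y j)"
      using y_le[of _ "Suc j"] by auto
    then show ?thesis
      using pos by simp
  qed
  moreover have "(1 - \<tau>) * \<phi> (y (Suc j)) \<le> (1 - \<tau>) * \<phi> ?u"
    using y_le[of "Suc j" "Suc j"] pos by simp
  ultimately show "t (Suc j) - \<epsilon> / 4 \<le> \<tau> * (t j - \<epsilon> / 4)"
    using * j by (simp add: t_def algebra_simps diff_divide_distrib)
qed

lemma serious_center: "t j \<le> \<epsilon> / 2 \<Longrightarrow> xc (Suc j) = x j"
  using run_serious(1) by (simp add: gap_eq)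

text \<open>
  When the gap is small, the proximal step is an approximate proximal step for the objective
  itself: unless \<open>y j\<close> is good enough, it moves closer to the solution by a definite amount.
\<close>

lemma serious_distance:
  assumes "j \<ge> 1" "t j \<le> \<epsilon> / 2" "\<not> eps_solution V f h \<epsilon> (y j)"
  shows "(1 + lam * \<mu>) * (norm (xs - x j))\<^sup>2 + lam * \<epsilon> \<le> (norm (xs - xc j))\<^sup>2"
proof -
  have "\<phi> (y j) - \<phi> xs > \<epsilon>"
    using assms(3) eps_solution_iff[OF y_D] by simp
  moreover have "\<phi> (y j) - m j \<le> \<epsilon> / 2"
    using assms(1,2) by (simp add: t_def)
  ultimately have "\<epsilon> / 2 + (1 + lam * \<mu>) * (norm (xs - x j))\<^sup>2 / (2 * lam)
      \<le> (norm (xs - xc j))\<^sup>2 / (2 * lam)"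
    using m_growth[OF assms(1)] by linarith
  then have "(2 * lam) * (\<epsilon> / 2 + (1 + lam * \<mu>) * (norm (xs - x j))\<^sup>2 / (2 * lam))
      \<le> (2 * lam) * ((norm (xs - xc j))\<^sup>2 / (2 * lam))"
    using pos by (intro mult_left_mono) auto
  then show ?thesis
    using pos by (simp add: distrib_left)
qed

text \<open>
  The first gap after a serious update is controlled by the step length \<open>r\<close>, and \<open>r\<close> by the
  distance \<open>d\<close> of the center \<open>c\<close> to the solution. Comparing the linearized objective with the
  objective directly at the new point costs \<open>L r\<^sup>2\<close>, which the proximal term \<open>r\<^sup>2 / (2 lam)\<close> only
  absorbs for small \<open>lam L\<close>. So the comparison is made at \<open>z\<close>, a fraction \<open>\<theta>\<close> of the way from the
  solution to the new point, with \<open>8 lam L \<theta> \<le> 1\<close>; convexity transfers the bound to the new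
  point, at the price of a factor \<open>1 / \<theta>\<close> on the terms involving \<open>d\<close>.
\<close>

lemma serious_gap:
  assumes serious: "t j \<le> \<epsilon> / 2" and d: "norm (xs - x j) \<le> d"
  shows "t (Suc j) \<le> 16 * t_bar M L lam d"
proof -
  define c u where "c = x j" and "u = x (Suc j)"
  define l where "l w = fr c + f' c \<bullet> (w - c)" for w
  define r where "r = norm (u - c)"
  define q where "q = max 1 (8 * lam * L)"
  define \<theta> where "\<theta> = 1 / q"
  define e where "e = q * d"
  have D: "c \<in> D" "u \<in> D"
    using x_D by (simp_all add: c_def u_def)
  have xc: "xc (Suc j) = c"
    using serious_center[OF serious] by (simp add: c_def)
  have q: "1 \<le> q" "8 * lam * L \<le> q"
    by (simp_all add: q_def)
  have \<theta>: "0 < \<theta>" "\<theta> \<le> 1" "q * \<theta> = 1"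
    using q by (simp_all add: \<theta>_def)
  have d0: "0 \<le> d"
    using d norm_ge_zero order_trans by blast
  have e: "d \<le> e"
    using q d0 by (simp add: e_def mult_le_cancel_right1)
  have r0: "0 \<le> r"
    by (simp add: r_def)
  have m: "l u + hr u + r\<^sup>2 / (2 * lam) \<le> m (Suc j)"
  proof -
    have "ereal (l u + hr u) \<le> \<Gamma> (Suc j) u"
      using run_serious(2)[of j u] serious D D_V[of u] linearization_eq[of c u]
      by (simp add: gap_eq l_def c_def)
    then have "l u + hr u \<le> real_of_ereal (\<Gamma> (Suc j) u)"
      using \<Gamma>_x_eq[of "Suc j"] by (metis Suc_leI One_nat_def ereal_less_eq(3) u_def zero_less_Suc)
    then show ?thesis
      by (simp add: m_def xc u_def[symmetric] r_def)
  qed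
  have "m (Suc j) \<le> \<phi> xs + d\<^sup>2 / (2 * lam)"
  proof -
    have "0 \<le> (1 + lam * \<mu>) * (norm (xs - x (Suc j)))\<^sup>2 / (2 * lam)"
      using pos nonneg by simp
    moreover have "(norm (xs - c))\<^sup>2 / (2 * lam) \<le> d\<^sup>2 / (2 * lam)"
      using d pos by (intro divide_right_mono power_mono) (auto simp: c_def)
    ultimately show ?thesis
      using m_growth[of "Suc j"] by (simp add: xc)
  qed
  then have "lam * (l u + hr u + r\<^sup>2 / (2 * lam)) \<le> lam * (\<phi> xs + d\<^sup>2 / (2 * lam))"
    using m pos by (intro mult_left_mono) auto
  then have upper: "r\<^sup>2 / 2 \<le> lam * (\<phi> xs - (l u + hr u)) + d\<^sup>2 / 2"
    using pos by (simp add: ring_distribs)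
  define z where "z = (1 - \<theta>) *\<^sub>R xs + \<theta> *\<^sub>R u"
  define n where "n = norm (z - c)"
  have zD: "z \<in> D" and hz: "hr z \<le> (1 - \<theta>) * hr xs + \<theta> * hr u"
  proof -
    have "0 \<le> \<mu> / 2 * (\<theta> * (1 - \<theta>) * (norm (u - xs))\<^sup>2)"
      using nonneg \<theta> by simp
    then show "z \<in> D" "hr z \<le> (1 - \<theta>) * hr xs + \<theta> * hr u"
      using Conv_bar_convex_combination[OF h_Conv xs_D D(2), of \<theta>] \<theta> by (auto simp: z_def hr_def)
  qed
  have zc: "z - c = (1 - \<theta>) *\<^sub>R (xs - c) + \<theta> *\<^sub>R (u - c)"
    by (simp add: z_def algebra_simps)
  have lz: "l z = (1 - \<theta>) * l xs + \<theta> * l u"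
    unfolding l_def zc by (simp add: inner_add_right algebra_simps)
  have n: "n \<le> \<theta> * r + d"
  proof -
    have "n \<le> (1 - \<theta>) * norm (xs - c) + \<theta> * r"
      unfolding n_def zc r_def using norm_triangle_ineq[of "(1 - \<theta>) *\<^sub>R (xs - c)" "\<theta> *\<^sub>R (u - c)"] \<theta>
      by simp
    moreover have "(1 - \<theta>) * norm (xs - c) \<le> 1 * d"
      using d \<theta> by (intro mult_mono) (auto simp: c_def)
    ultimately show ?thesis
      by simp
  qed
  have "n\<^sup>2 \<le> (\<theta> * r + d)\<^sup>2"
    using n by (intro power_mono) (auto simp: n_def)
  moreover have "0 \<le> (\<theta> * r - d)\<^sup>2"
    by simp
  ultimately have n2: "n\<^sup>2 \<le> 2 * (\<theta> * r)\<^sup>2 + 2 * d\<^sup>2"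
    by (simp add: power2_sum power2_diff)
  have "\<phi> xs \<le> l z + hr z + 2 * M * n + L * n\<^sup>2"
    using \<phi>_xs_le[OF zD] linearization_error[OF D(1) zD] by (simp add: \<phi>_def l_def n_def)
  also have "\<dots> \<le> (1 - \<theta>) * (l xs + hr xs) + \<theta> * (l u + hr u) + 2 * M * n + L * n\<^sup>2"
    using hz lz by (simp add: algebra_simps)
  also have "\<dots> \<le> (1 - \<theta>) * \<phi> xs + \<theta> * (l u + hr u) + 2 * M * (\<theta> * r + d)
      + L * (2 * (\<theta> * r)\<^sup>2 + 2 * d\<^sup>2)"
    using linearization_le[OF D(1) xs_D] \<theta> n n2 nonneg
    by (intro add_mono mult_left_mono) (auto simp: \<phi>_def l_def)
  finally have "\<theta> * (\<phi> xs - (l u + hr u)) \<le> 2 * M * (\<theta> * r + d) + L * (2 * (\<theta> * r)\<^sup>2 + 2 * d\<^sup>2)"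
    by (simp add: algebra_simps)
  then have "lam * q * (\<theta> * (\<phi> xs - (l u + hr u)))
      \<le> lam * q * (2 * M * (\<theta> * r + d) + L * (2 * (\<theta> * r)\<^sup>2 + 2 * d\<^sup>2))"
    using pos q by (intro mult_left_mono) auto
  moreover have "lam * q * (\<theta> * (\<phi> xs - (l u + hr u))) = (q * \<theta>) * (lam * (\<phi> xs - (l u + hr u)))"
    by (simp only: mult_ac)
  moreover have "lam * q * (2 * M * (\<theta> * r + d) + L * (2 * (\<theta> * r)\<^sup>2 + 2 * d\<^sup>2))
      = 2 * (lam * M) * ((q * \<theta>) * r + e) + (8 * lam * L) * (q * \<theta>) * (\<theta> * r\<^sup>2) / 4
        + (8 * lam * L) * (q * d\<^sup>2) / 4"
    by (simp add: e_def power2_eq_square algebra_simps)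
  ultimately have "lam * (\<phi> xs - (l u + hr u)) \<le> 2 * (lam * M) * (r + e)
      + (8 * lam * L) * (\<theta> * r\<^sup>2) / 4 + (8 * lam * L) * (q * d\<^sup>2) / 4"
    by (simp add: \<theta>(3))
  also have "\<dots> \<le> 2 * (lam * M) * (r + e) + q * (\<theta> * r\<^sup>2) / 4 + q * (q * d\<^sup>2) / 4"
    using q \<theta> pos nonneg r0 d0 e by (intro add_mono divide_right_mono mult_right_mono) auto
  (* the fraction was chosen so that the quadratic error in r is half of the proximal term *)
  also have "\<dots> = 2 * (lam * M) * (r + e) + (q * \<theta>) * r\<^sup>2 / 4 + e\<^sup>2 / 4"
    by (simp add: e_def power2_eq_square mult_ac)
  finally have "r\<^sup>2 / 4 \<le> 2 * (lam * M) * (r + e) + e\<^sup>2 / 4 + d\<^sup>2 / 2"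
    using upper by (simp add: \<theta>(3))
  moreover have "d\<^sup>2 \<le> e\<^sup>2"
    using e d0 by (rule power_mono)
  ultimately have "r\<^sup>2 \<le> 8 * (lam * M) * (r + e) + 3 * e\<^sup>2"
    by simp
  moreover have "0 \<le> lam * M * e"
    using pos nonneg e d0 by simp
  ultimately have "0 \<le> (8 * (lam * M) * (r + e) + 3 * e\<^sup>2 - r\<^sup>2) + 8 * (lam * M * e) + e\<^sup>2"
    by (intro add_nonneg_nonneg) simp_all
  (* completing the square solves the quadratic inequality for r *)
  also have "\<dots> = (4 * (lam * M) + 2 * e)\<^sup>2 - (r - 4 * (lam * M))\<^sup>2"
    by (simp add: power2_eq_square algebra_simps)
  finally have "(r - 4 * (lam * M))\<^sup>2 \<le> (4 * (lam * M) + 2 * e)\<^sup>2"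
    by (simp only: diff_ge_0_iff_ge)
  then have "r - 4 * (lam * M) \<le> 4 * (lam * M) + 2 * e"
    by (rule power2_le_imp_le) (use pos nonneg e d0 in simp)
  moreover have "e \<le> 4 * (max 1 (2 * lam * L) * d)"
  proof -
    have "1 \<le> max 1 (2 * lam * L)" "2 * lam * L \<le> max 1 (2 * lam * L)"
      by simp_all
    then have "q \<le> 4 * max 1 (2 * lam * L)"
      unfolding q_def by (intro max.boundedI) linarith+
    from mult_right_mono[OF this d0] show ?thesis
      by (simp add: e_def)
  qed
  ultimately have "r \<le> 8 * (max 1 (2 * lam * L) * d + lam * M)"
    unfolding distrib_left by linarith
  then have "r\<^sup>2 \<le> (8 * (max 1 (2 * lam * L) * d + lam * M))\<^sup>2"
    using r0 by (rule power_mono)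
  then have r2: "r\<^sup>2 \<le> 64 * (max 1 (2 * lam * L) * d + lam * M)\<^sup>2"
    by (simp only: power_mult_distrib) simp
  have "t (Suc j) = \<phi> (y (Suc j)) - m (Suc j)"
    by (simp add: t_def)
  also have "\<dots> \<le> \<phi> u - (l u + hr u)"
  proof -
    have "0 \<le> r\<^sup>2 / (2 * lam)"
      using pos by simp
    then show ?thesis
      using m y_le[of "Suc j" "Suc j"] by (simp add: u_def)
  qed
  also have "\<dots> \<le> 2 * M * r + L * r\<^sup>2"
    using linearization_error[OF D] by (simp add: \<phi>_def l_def r_def)
  also have "\<dots> \<le> M\<^sup>2 + (L + 2) * r\<^sup>2"
  proof -
    have "2 * M * r \<le> M\<^sup>2 + r\<^sup>2"
      using zero_le_power2[of "M - r"] unfolding power2_diff by linarith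
    moreover have "0 \<le> r\<^sup>2"
      by simp
    ultimately show ?thesis
      unfolding distrib_right by linarith
  qed
  also have "\<dots> \<le> 16 * M\<^sup>2 + (L + 2) * (64 * (max 1 (2 * lam * L) * d + lam * M)\<^sup>2)"
    using r2 nonneg by (intro add_mono mult_left_mono) auto
  also have "\<dots> = 16 * t_bar M L lam d"
    by (simp add: t_bar_def algebra_simps)
  finally show ?thesis .
qed

section \<open>Counting iterations\<close>

text \<open>
  Here \<open>k\<close> is the number of completed cycles and \<open>p\<close> the number of null updates in the current
  one. The third conjunct accumulates \<open>serious_distance\<close> over the completed cycles. The last one
  iterates \<open>null_gap\<close> within the current cycle; since a null update only occurs while the gap
  exceeds \<open>\<epsilon> / 2\<close>, it keeps the cycle from becoming longer than \<open>N\<close>.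
\<close>

lemma cycle_invariant:
  fixes d B N a :: real
  defines "d \<equiv> norm (x0 - xs)" and "B \<equiv> 16 * t_bar M L lam d" and "a \<equiv> 1 + lam * \<mu>"
  defines "N \<equiv> 2 + log_plus (4 * B / \<epsilon>) / (1 - \<tau>)"
  assumes "j \<ge> 1" and "\<And>i. i < j \<Longrightarrow> \<not> eps_solution V f h \<epsilon> (y i)"
  shows "\<exists>k p. real j \<le> real k * N + real p + 1 \<and> real p + 1 \<le> N \<and>
    a ^ k * (norm (xs - xc j))\<^sup>2 + lam * \<epsilon> * (\<Sum>i<k. a ^ i) \<le> d\<^sup>2 \<and>
    t j - \<epsilon> / 4 \<le> \<tau> ^ p * B"
  using assms(5,6)
proof (induction j rule: nat_induct_at_least)
  case base
  have N: "1 \<le> N"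
    using pos by (simp add: N_def log_plus_def)
  have t0: "t 0 \<le> \<epsilon> / 2"
    using pos by (simp add: t_def)
  have dx: "norm (xs - x 0) = d"
    by (simp add: d_def x_0 norm_minus_commute)
  have c1: "xc (Suc 0) = x 0"
    using serious_center[OF t0] by simp
  have "t 1 \<le> B"
    using serious_gap[OF t0, of d] dx by (simp add: B_def)
  then show ?case
    using N pos dx by (intro exI[of _ 0]) (simp add: c1)
next
  case (Suc j)
  have none: "\<not> eps_solution V f h \<epsilon> (y i)" if "i < j" for i
    using Suc.prems[of i] that by simp
  obtain k p where j: "real j \<le> real k * N + real p + 1" and p: "real p + 1 \<le> N"
    and dist: "a ^ k * (norm (xs - xc j))\<^sup>2 + lam * \<epsilon> * (\<Sum>i<k. a ^ i) \<le> d\<^sup>2"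
    and gap: "t j - \<epsilon> / 4 \<le> \<tau> ^ p * B"
    using Suc.IH[OF none] by blast
  have a: "1 \<le> a"
    using pos nonneg by (simp add: a_def)
  have N: "1 \<le> N"
    using pos by (simp add: N_def log_plus_def)
  show ?case
  proof (cases "t j \<le> \<epsilon> / 2")
    case True
    have c: "xc (Suc j) = x j"
      by (rule serious_center[OF True])
    have "a * (norm (xs - x j))\<^sup>2 + lam * \<epsilon> \<le> (norm (xs - xc j))\<^sup>2"
      unfolding a_def using Suc.hyps True Suc.prems[of j] by (intro serious_distance) simp_all
    then have "a ^ k * (a * (norm (xs - x j))\<^sup>2 + lam * \<epsilon>) \<le> a ^ k * (norm (xs - xc j))\<^sup>2"
      using a by (intro mult_left_mono) auto
    then have dist': "a ^ Suc k * (norm (xs - x j))\<^sup>2 + lam * \<epsilon> * (\<Sum>i<Suc k. a ^ i) \<le> d\<^sup>2"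
      using dist by (simp add: algebra_simps)
    moreover have "1 * (norm (xs - x j))\<^sup>2 \<le> a ^ Suc k * (norm (xs - x j))\<^sup>2"
      using one_le_power[OF a, of "Suc k"] by (rule mult_right_mono) simp
    moreover have "0 \<le> lam * \<epsilon> * (\<Sum>i<Suc k. a ^ i)"
      using pos a by (intro mult_nonneg_nonneg sum_nonneg) auto
    ultimately have "(norm (xs - x j))\<^sup>2 \<le> d\<^sup>2"
      by linarith
    then have "norm (xs - x j) \<le> d"
      by (rule power2_le_imp_le) (simp add: d_def)
    then have "t (Suc j) \<le> B"
      using serious_gap[OF True] by (simp add: B_def)
    moreover have "real (Suc j) \<le> real (Suc k) * N + real 0 + 1"
      using j p by (simp add: algebra_simps)
    ultimately show ?thesis
      using N dist' pos by (intro exI[of _ "Suc k"] exI[of _ 0]) (auto simp: c)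
  next
    case False
    have "t (Suc j) - \<epsilon> / 4 \<le> \<tau> * (t j - \<epsilon> / 4)"
      by (rule null_gap(2)[OF False])
    also have "\<dots> \<le> \<tau> * (\<tau> ^ p * B)"
      using gap pos by (intro mult_left_mono) auto
    finally have gap': "t (Suc j) - \<epsilon> / 4 \<le> \<tau> ^ Suc p * B"
      by simp
    have large: "\<epsilon> / 4 < \<tau> ^ p * B"
      using False gap by simp
    then have B: "0 < B"
      using pos zero_less_mult_pos[of "\<tau> ^ p" B] by simp
    have "ln (\<epsilon> / 4) < ln (\<tau> ^ p * B)"
      using large pos B by simp
    then have "real p * (- ln \<tau>) < ln (4 * B / \<epsilon>)"
      using pos B by (simp add: ln_mult ln_div ln_realpow)
    moreover have "real p * (1 - \<tau>) \<le> real p * (- ln \<tau>)"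
      using ln_le_minus_one[of \<tau>] pos by (intro mult_left_mono) auto
    moreover have "ln (4 * B / \<epsilon>) \<le> log_plus (4 * B / \<epsilon>)"
      by (simp add: log_plus_def)
    ultimately have "real p * (1 - \<tau>) \<le> log_plus (4 * B / \<epsilon>)"
      by linarith
    then have "real p \<le> log_plus (4 * B / \<epsilon>) / (1 - \<tau>)"
      using pos by (simp add: pos_le_divide_eq)
    then have "real (Suc p) + 1 \<le> N"
      by (simp add: N_def)
    moreover have "real (Suc j) \<le> real k * N + real (Suc p) + 1"
      using j by simp
    ultimately show ?thesis
      using dist gap' by (intro exI[of _ k] exI[of _ "Suc p"]) (simp add: null_gap(1)[OF False])
  qed
qed

end

section \<open>The complexity bound\<close>

lemma log_plus_mult_16:
  assumes "0 \<le> s"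
  shows "log_plus (16 * s) \<le> 4 + log_plus s"
proof (cases "s = 0")
  case False
  have "ln (16::real) = 4 * ln 2"
    using ln_realpow[of 2 4] by simp
  moreover have "ln 2 \<le> (1::real)"
    using ln_le_minus_one[of 2] by simp
  ultimately have "ln (16 * s) \<le> 4 + ln s"
    using False assms by (simp add: ln_mult)
  then show ?thesis
    using False by (simp add: log_plus_def)
qed (simp add: log_plus_def)

text \<open>
  Conversion of the cycle count into the announced bound. The condition on \<open>k\<close> yields both
  \<open>k \<le> d\<^sup>2 / (lam \<epsilon>)\<close> and, by summing the geometric series, a logarithmic bound on \<open>k\<close>. The lower
  bound on \<open>lam\<close> absorbs the summand 1 of the cycle length, the upper one the last, incomplete
  cycle.
\<close>

lemma cycles_times_length_le_bound:
  fixes C K \<epsilon> \<mu> lam d :: real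
  assumes C: "0 < C" and K: "0 < K" and \<epsilon>: "0 < \<epsilon>" and lam: "0 < lam" and \<mu>: "0 \<le> \<mu>"
    and lower: "\<epsilon> / (C * K) \<le> lam" and upper: "lam \<le> C * d\<^sup>2 / \<epsilon>"
    and k: "lam * \<epsilon> * (\<Sum>i<k. (1 + lam * \<mu>) ^ i) \<le> d\<^sup>2"
  shows "(real k + 1) * (1 + 8 * lam * K / ((1 + lam * \<mu>) * \<epsilon>))
    \<le> (17 + 9 * C + C\<^sup>2) * gpb_bound K \<epsilon> \<mu> d"
proof -
  define a where "a = 1 + lam * \<mu>"
  define w where "w = lam * K / \<epsilon>"
  define b1 where "b1 = K * d\<^sup>2 / \<epsilon>\<^sup>2"
  define X where "X = \<mu> * d\<^sup>2 / \<epsilon>"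
  define \<Lambda> where "\<Lambda> = ln (X + 1)"
  define Q where "Q = 17 + 9 * C + C\<^sup>2"
  have a: "1 \<le> a"
    using lam \<mu> by (simp add: a_def)
  have w: "1 \<le> C * w"
    using lower C K \<epsilon> by (simp add: w_def field_simps)
  have w0: "0 < w"
    using lam K \<epsilon> by (simp add: w_def)
  have Q1: "1 \<le> Q"
    using C by (simp add: Q_def)
  have len: "8 * lam * K / ((1 + lam * \<mu>) * \<epsilon>) = 8 * w / a"
    using \<epsilon> a by (simp add: w_def a_def field_simps)
  define kk where "kk = real k"
  have kk0: "0 \<le> kk"
    by (simp add: kk_def)
  have b1: "(kk + 1) * (1 + 8 * w / a) \<le> Q * b1"
  proof -
    define s where "s = d\<^sup>2 / (lam * \<epsilon>)"
    have s0: "0 \<le> s"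
      using lam \<epsilon> by (simp add: s_def)
    have "kk = (\<Sum>i<k. 1)"
      by (simp add: kk_def)
    also have "\<dots> \<le> (\<Sum>i<k. a ^ i)"
      using a by (intro sum_mono) (simp add: one_le_power)
    finally have "lam * \<epsilon> * kk \<le> d\<^sup>2"
      using k lam \<epsilon> by (intro order_trans[OF mult_left_mono k]) (auto simp: a_def)
    then have "kk \<le> s"
      using lam \<epsilon> by (simp add: s_def field_simps)
    moreover have "1 \<le> C * s"
      using upper lam \<epsilon> by (simp add: s_def field_simps)
    ultimately have "kk + 1 \<le> (1 + C) * s"
      by (simp add: algebra_simps)
    moreover have "8 * w / a \<le> 8 * w"
      using a w0 by (simp add: divide_le_eq mult_le_cancel_left1)
    then have "1 + 8 * w / a \<le> (C + 8) * w"
      using w by (simp add: algebra_simps)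
    ultimately have "(kk + 1) * (1 + 8 * w / a) \<le> ((1 + C) * s) * ((C + 8) * w)"
      using kk0 w0 a s0 C by (intro mult_mono) auto
    also have "\<dots> = ((1 + C) * (C + 8)) * (s * w)"
      by (simp add: mult_ac)
    also have "\<dots> \<le> Q * (s * w)"
      using C s0 w0 by (intro mult_right_mono) (auto simp: Q_def power2_eq_square algebra_simps)
    also have "s * w = b1"
      using lam \<epsilon> by (simp add: s_def w_def b1_def power2_eq_square)
    finally show ?thesis .
  qed
  have b2: "(kk + 1) * (1 + 8 * w / a) \<le> Q * ((K / (\<mu> * \<epsilon>) + 1) * \<Lambda> + 1)" if "\<mu> \<noteq> 0"
  proof -
    have \<mu>: "0 < \<mu>"
      using that \<mu> by simp
    define v where "v = lam * \<mu>"
    define g where "g = K / (\<mu> * \<epsilon>)"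
    have v: "0 < v" and av: "a = 1 + v"
      using lam \<mu> by (simp_all add: v_def a_def)
    have g: "0 < g" and wg: "w = v * g"
      using K \<epsilon> \<mu> by (simp_all add: g_def w_def v_def)
    have X: "0 \<le> X"
      using \<mu> \<epsilon> by (simp add: X_def)
    have vX: "v \<le> C * X"
      using mult_right_mono[OF upper, of \<mu>] \<mu> by (simp add: v_def X_def mult_ac)
    have log: "1 - 1 / z \<le> ln z" if "0 < z" for z :: real
      using ln_le_minus_one[of "1 / z"] that by (simp add: ln_div)
    (* the incomplete cycle is compared with the logarithm through X / (1 + X) *)
    have \<Lambda>: "X / (1 + X) \<le> \<Lambda>"
      using log[of "X + 1"] X by (simp add: \<Lambda>_def field_simps)
    have \<Lambda>0: "0 \<le> \<Lambda>"
      using X by (simp add: \<Lambda>_def)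
    have "v * (\<Sum>i<k. a ^ i) = a ^ k - 1"
      using power_diff_1_eq[of a k] by (simp add: av)
    then have "\<epsilon> * (a ^ k - 1) \<le> \<mu> * d\<^sup>2"
      using mult_left_mono[OF k, of \<mu>] \<mu> by (simp add: v_def a_def mult_ac)
    then have "a ^ k \<le> X + 1"
      using \<epsilon> by (simp add: X_def field_simps)
    then have "ln (a ^ k) \<le> \<Lambda>"
      unfolding \<Lambda>_def using a X by (intro ln_mono) auto
    then have "kk * ln a \<le> \<Lambda>"
      using a by (simp add: ln_realpow kk_def)
    moreover have "kk * (v / a) \<le> kk * ln a"
      using log[of a] v kk0 by (intro mult_left_mono) (auto simp: av field_simps)
    ultimately have kv: "kk * (v / a) \<le> \<Lambda>"
      by linarith
    then have kva: "kk * v \<le> \<Lambda> * (1 + v)"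
      using v by (simp add: av field_simps)
    have "kk \<le> \<Lambda> + C * (g * \<Lambda>)"
    proof -
      have "\<Lambda> * 1 \<le> \<Lambda> * (C * (v * g))"
        using w \<Lambda>0 unfolding wg by (rule mult_left_mono)
      then have "kk * v \<le> v * (\<Lambda> + C * (g * \<Lambda>))"
        using kva by (simp add: algebra_simps)
      then show ?thesis
        using v by (simp add: mult.commute)
    qed
    moreover have "kk * (8 * w / a) \<le> 8 * (g * \<Lambda>)"
      using mult_right_mono[OF kv, of "8 * g"] g by (simp add: wg mult_ac)
    moreover have "8 * w / a \<le> 8 * (1 + C) * (g * \<Lambda>)"
    proof -
      have "v / a \<le> (1 + C) * (X / (1 + X))"
      proof -
        have "0 \<le> (X + C * X) * v - X * v"
          using C X v by (simp add: algebra_simps)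
        then have "v * (1 + X) \<le> (1 + C) * X * (1 + v)"
          using vX X by (simp add: algebra_simps)
        then show ?thesis
          using v X by (simp add: av field_simps)
      qed
      also have "\<dots> \<le> (1 + C) * \<Lambda>"
        using \<Lambda> C by (intro mult_left_mono) auto
      finally have "v / a \<le> (1 + C) * \<Lambda>" .
      from mult_right_mono[OF this, of "8 * g"] show ?thesis
        using g by (simp add: wg algebra_simps)
    qed
    ultimately have "(kk + 1) * (1 + 8 * w / a) \<le> \<Lambda> + (16 + 9 * C) * (g * \<Lambda>) + 1"
      by (simp add: algebra_simps add_divide_distrib)
    also have "\<dots> \<le> Q * \<Lambda> + Q * (g * \<Lambda>) + Q * 1"
    proof (intro add_mono)
      show "\<Lambda> \<le> Q * \<Lambda>"
        using Q1 \<Lambda>0 by (simp add: mult_le_cancel_right1)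
      show "(16 + 9 * C) * (g * \<Lambda>) \<le> Q * (g * \<Lambda>)"
        using g \<Lambda>0 C by (intro mult_right_mono) (auto simp: Q_def)
    qed (use Q1 in simp)
    finally show ?thesis
      by (simp add: g_def algebra_simps)
  qed
  have "gpb_bound K \<epsilon> \<mu> d = b1 + 1 \<or>
      \<mu> \<noteq> 0 \<and> gpb_bound K \<epsilon> \<mu> d = (K / (\<mu> * \<epsilon>) + 1) * \<Lambda> + 1"
    by (simp add: gpb_bound_def Let_def b1_def \<Lambda>_def X_def min_def)
  moreover have "(kk + 1) * (1 + 8 * w / a) \<le> Q * (b1 + 1)"
    using b1 Q1 by (simp add: algebra_simps)
  ultimately have "(kk + 1) * (1 + 8 * w / a) \<le> Q * gpb_bound K \<epsilon> \<mu> d"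
    using b2 by auto
  then show ?thesis
    unfolding len by (simp add: kk_def Q_def)
qed

text \<open>
  At the first success the invariant still holds, because it only needs the earlier iterates to
  be unsuccessful; and it cannot hold for arbitrarily large indices.
\<close>

lemma (in gpb_iteration) iteration_count:
  fixes C K d :: real
  defines "d \<equiv> norm (x0 - xs)"
  assumes C: "0 < C" and K: "0 < K"
    and lower: "\<epsilon> / (C * K) \<le> lam" and upper: "lam \<le> C * d\<^sup>2 / \<epsilon>"
    and \<tau>: "\<tau> = inverse (1 + (1 + lam * \<mu>) * \<epsilon> / (8 * lam * K))"
  shows "\<exists>j. eps_solution V f h \<epsilon> (y j)"
    and "real (LEAST j. eps_solution V f h \<epsilon> (y j))
      \<le> 6 * (17 + 9 * C + C\<^sup>2) * (1 + log_plus (4 * t_bar M L lam d / \<epsilon>)) * gpb_bound K \<epsilon> \<mu> d"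
      (is "_ \<le> ?R")
proof -
  define s where "s = 8 * lam * K / ((1 + lam * \<mu>) * \<epsilon>)"
  define N where "N = 2 + log_plus (4 * (16 * t_bar M L lam d) / \<epsilon>) / (1 - \<tau>)"
  define lp where "lp = log_plus (4 * t_bar M L lam d / \<epsilon>)"
  have a: "0 < 1 + lam * \<mu>"
    using pos nonneg by (simp add: add_pos_nonneg)
  have s0: "0 < s"
    using pos K a by (simp add: s_def)
  have "(1 + lam * \<mu>) * \<epsilon> / (8 * lam * K) = 1 / s"
    by (simp add: s_def)
  then have "\<tau> = inverse (1 + 1 / s)"
    using \<tau> by simp
  then have \<tau>': "\<tau> = s / (1 + s)"
    using s0 by (simp add: field_simps)
  have \<tau>s: "1 / (1 - \<tau>) = 1 + s"
    unfolding \<tau>' using s0 by (simp add: field_simps)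
  have t0: "0 \<le> 4 * t_bar M L lam d / \<epsilon>"
    using nonneg pos by (simp add: t_bar_def)
  have lp0: "0 \<le> lp"
    by (simp add: lp_def log_plus_def)
  have "4 * (16 * t_bar M L lam d) / \<epsilon> = 16 * (4 * t_bar M L lam d / \<epsilon>)"
    by simp
  then have "log_plus (4 * (16 * t_bar M L lam d) / \<epsilon>) \<le> 4 + lp"
    using log_plus_mult_16[OF t0] unfolding lp_def by metis
  then have "log_plus (4 * (16 * t_bar M L lam d) / \<epsilon>) * (1 / (1 - \<tau>)) \<le> (4 + lp) * (1 + s)"
    unfolding \<tau>s using s0 by (intro mult_right_mono) auto
  then have "N \<le> 2 + (4 + lp) * (1 + s)"
    by (simp add: N_def)
  also have "\<dots> \<le> 6 * (1 + lp) * (1 + s)"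
    using s0 lp0 by (simp add: algebra_simps add_nonneg_nonneg)
  finally have N: "N \<le> 6 * (1 + lp) * (1 + s)" .
  have main: "real j \<le> ?R" if none: "\<And>i. i < j \<Longrightarrow> \<not> eps_solution V f h \<epsilon> (y i)" and j: "j \<ge> 1" for j
  proof -
    obtain k p where j: "real j \<le> real k * N + real p + 1" and p: "real p + 1 \<le> N"
      and dist: "(1 + lam * \<mu>) ^ k * (norm (xs - xc j))\<^sup>2
        + lam * \<epsilon> * (\<Sum>i<k. (1 + lam * \<mu>) ^ i) \<le> d\<^sup>2"
      using cycle_invariant[OF j none] unfolding N_def d_def by blast
    have "0 \<le> (1 + lam * \<mu>) ^ k * (norm (xs - xc j))\<^sup>2"
      using a by simp
    then have k: "lam * \<epsilon> * (\<Sum>i<k. (1 + lam * \<mu>) ^ i) \<le> d\<^sup>2"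
      using dist by linarith
    have "real j \<le> (real k + 1) * N"
      using j p by (simp add: algebra_simps)
    also have "\<dots> \<le> (real k + 1) * (6 * (1 + lp) * (1 + s))"
      using N by (intro mult_left_mono) auto
    also have "\<dots> = 6 * (1 + lp) * ((real k + 1) * (1 + s))"
      by (simp only: mult_ac)
    also have "\<dots> \<le> 6 * (1 + lp) * ((17 + 9 * C + C\<^sup>2) * gpb_bound K \<epsilon> \<mu> d)"
      using cycles_times_length_le_bound[OF C K pos(2) pos(1) nonneg(1) lower upper k] lp0
      by (intro mult_left_mono) (auto simp: s_def)
    finally show ?thesis
      unfolding lp_def by (simp only: mult_ac)
  qed
  show ex: "\<exists>j. eps_solution V f h \<epsilon> (y j)"
  proof (rule ccontr)
    assume "\<not> ?thesis"
    then have "real j \<le> ?R" if "j \<ge> 1" for j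
      using main that by blast
    moreover obtain j :: nat where j: "max 1 ?R < real j"
      using reals_Archimedean2 by blast
    moreover have "j \<ge> 1"
      using j by simp
    ultimately show False
      by (metis max_less_iff_conj not_less)
  qed
  show "real (LEAST j. eps_solution V f h \<epsilon> (y j)) \<le> ?R" (is "real ?J \<le> _")
  proof (cases "?J = 0")
    case True
    have "0 \<le> gpb_bound K \<epsilon> \<mu> d"
      using K pos nonneg by (auto simp: gpb_bound_def Let_def min_def)
    then have "0 \<le> ?R"
      using C lp0 by (intro mult_nonneg_nonneg) (auto simp: lp_def)
    then show ?thesis
      using True by simp
  next
    case False
    then show ?thesis
      using main[of ?J] not_less_Least by (metis Suc_leI One_nat_def neq0_conv)
  qed
qed

theorem theorem3p1:
  fixes C :: real
  assumes "0 < C"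
  shows "\<exists>C'>0. \<forall>(n::nat) (f :: (nat \<Rightarrow>\<^sub>0 real) \<Rightarrow> ereal) f' h M\<^sub>f L\<^sub>f \<mu> x0 \<epsilon> x0s d\<^sub>0 Mb Lb lam \<tau>.
    0 \<le> L\<^sub>f \<and> 0 \<le> M\<^sub>f \<and> 0 \<le> \<mu> \<and> 0 < \<epsilon> \<and> x0 \<in> edom (Rn n) h \<and>
    assumption_A1 (Rn n) f f' h \<mu> \<and>
    assumption_A2 (Rn n) f h \<and>
    assumption_A3 (Rn n) f' h M\<^sub>f L\<^sub>f \<and>
    is_arg_min (\<lambda>z. norm (x0 - z)) (\<lambda>z. z \<in> opt_set (Rn n) f h) x0s \<and>
    d\<^sub>0 = norm (x0 - x0s) \<and>
    is_arg_min (\<lambda>(M, L). M\<^sup>2 + \<epsilon> * L) (\<lambda>p. p \<in> Omega (Rn n) f' h) (Mb, Lb) \<and>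
    0 < M\<^sub>f\<^sup>2 + \<epsilon> * L\<^sub>f \<and> 0 < lam \<and>
    \<epsilon> / (C * (M\<^sub>f\<^sup>2 + \<epsilon> * L\<^sub>f)) \<le> lam \<and> lam \<le> C * d\<^sub>0\<^sup>2 / \<epsilon> \<and>
    \<tau> = inverse (1 + (1 + lam * \<mu>) * \<epsilon> / (8 * lam * (M\<^sub>f\<^sup>2 + \<epsilon> * L\<^sub>f)))
    \<longrightarrow>
    gpb_input (Rn n) h \<mu> (T_eps \<epsilon> Mb Lb) x0 lam \<epsilon> \<tau> \<and>
    (\<forall>\<Gamma> xc x y. gpb_run (Rn n) f f' h \<mu> x0 lam \<epsilon> \<tau> \<Gamma> xc x y \<longrightarrow>
      (\<exists>j. eps_solution (Rn n) f h \<epsilon> (y j)) \<and>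
      real (LEAST j. eps_solution (Rn n) f h \<epsilon> (y j))
        \<le> C' * (1 + log_plus (4 * t_bar Mb Lb lam d\<^sub>0 / \<epsilon>)) *
           gpb_bound (M\<^sub>f\<^sup>2 + \<epsilon> * L\<^sub>f) \<epsilon> \<mu> d\<^sub>0)"
proof (intro exI[of _ "6 * (17 + 9 * C + C\<^sup>2)"] conjI allI impI; (elim conjE)?)
  show "0 < 6 * (17 + 9 * C + C\<^sup>2)"
    using assms by (simp add: add_pos_nonneg)
next
  fix n :: nat and f :: "(nat \<Rightarrow>\<^sub>0 real) \<Rightarrow> ereal"
    and f' h M\<^sub>f L\<^sub>f \<mu> x0 \<epsilon> x0s d\<^sub>0 Mb Lb lam \<tau>
  assume nonneg: "0 \<le> L\<^sub>f" "0 \<le> M\<^sub>f" "0 \<le> \<mu>" and \<epsilon>: "0 < \<epsilon>" and x0: "x0 \<in> edom (Rn n) h"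
    and A: "assumption_A1 (Rn n) f f' h \<mu>" "assumption_A3 (Rn n) f' h M\<^sub>f L\<^sub>f"
    and x0s: "is_arg_min (\<lambda>z. norm (x0 - z)) (\<lambda>z. z \<in> opt_set (Rn n) f h) x0s"
    and d0: "d\<^sub>0 = norm (x0 - x0s)"
    and minimal: "is_arg_min (\<lambda>(M, L). M\<^sup>2 + \<epsilon> * L) (\<lambda>p. p \<in> Omega (Rn n) f' h) (Mb, Lb)"
    and K: "0 < M\<^sub>f\<^sup>2 + \<epsilon> * L\<^sub>f" and lam: "0 < lam"
    and lower: "\<epsilon> / (C * (M\<^sub>f\<^sup>2 + \<epsilon> * L\<^sub>f)) \<le> lam" and upper: "lam \<le> C * d\<^sub>0\<^sup>2 / \<epsilon>"
    and \<tau>: "\<tau> = inverse (1 + (1 + lam * \<mu>) * \<epsilon> / (8 * lam * (M\<^sub>f\<^sup>2 + \<epsilon> * L\<^sub>f)))"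
  define K where "K = M\<^sub>f\<^sup>2 + \<epsilon> * L\<^sub>f"
  define s where "s = 8 * lam * K / ((1 + lam * \<mu>) * \<epsilon>)"
  have K0: "0 < K"
    using K by (simp add: K_def)
  have a: "0 < 1 + lam * \<mu>"
    using lam nonneg by (simp add: add_pos_nonneg)
  have s0: "0 < s"
    using lam K0 a \<epsilon> by (simp add: s_def)
  have "(1 + lam * \<mu>) * \<epsilon> / (8 * lam * K) = 1 / s"
    by (simp add: s_def)
  then have "\<tau> = inverse (1 + 1 / s)"
    using \<tau> by (simp add: K_def)
  then have \<tau>s: "\<tau> = s / (1 + s)"
    using s0 by (simp add: field_simps)
  have "0 < \<tau>" "\<tau> < 1" "\<tau> / (1 - \<tau>) = s"
    unfolding \<tau>s using s0 by (simp_all add: field_simps)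
  have Mb: "0 \<le> Mb" "0 \<le> Lb" "assumption_A3 (Rn n) f' h Mb Lb"
    using minimal by (auto simp: is_arg_min_def Omega_def)
  (* minimality of (Mb, Lb) is what makes the given value of tau large enough *)
  have "Mb\<^sup>2 + \<epsilon> * Lb \<le> K"
  proof -
    have "(M\<^sub>f, L\<^sub>f) \<in> Omega (Rn n) f' h"
      using nonneg A(2) by (simp add: Omega_def)
    then have "\<not> M\<^sub>f\<^sup>2 + \<epsilon> * L\<^sub>f < Mb\<^sup>2 + \<epsilon> * Lb"
      using minimal unfolding is_arg_min_def by auto
    then show ?thesis
      by (simp add: K_def)
  qed
  then have T: "(T_eps \<epsilon> Mb Lb)\<^sup>2 \<le> K"
    using Mb \<epsilon> by (simp add: T_eps_def)
  have "8 * lam * (T_eps \<epsilon> Mb Lb)\<^sup>2 / ((1 + lam * \<mu>) * \<epsilon>) \<le> s"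
    unfolding s_def using T lam a \<epsilon> by (intro divide_right_mono mult_left_mono) auto
  then show input: "gpb_input (Rn n) h \<mu> (T_eps \<epsilon> Mb Lb) x0 lam \<epsilon> \<tau>"
    using x0 lam \<epsilon> \<open>0 < \<tau>\<close> \<open>\<tau> < 1\<close> \<open>\<tau> / (1 - \<tau>) = s\<close> by (simp add: gpb_input_def)
  fix \<Gamma> xc x y
  assume run: "gpb_run (Rn n) f f' h \<mu> x0 lam \<epsilon> \<tau> \<Gamma> xc x y"
  interpret gpb_iteration "Rn n" f f' h \<mu> Mb Lb \<epsilon> lam \<tau> x0 x0s \<Gamma> xc x y
    using A Mb nonneg x0s input run by unfold_locales (auto simp: is_arg_min_def)
  show "\<exists>j. eps_solution (Rn n) f h \<epsilon> (y j)"
    and "real (LEAST j. eps_solution (Rn n) f h \<epsilon> (y j))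
      \<le> 6 * (17 + 9 * C + C\<^sup>2) * (1 + log_plus (4 * t_bar Mb Lb lam d\<^sub>0 / \<epsilon>)) *
        gpb_bound (M\<^sub>f\<^sup>2 + \<epsilon> * L\<^sub>f) \<epsilon> \<mu> d\<^sub>0"
    unfolding d0 by (rule iteration_count[OF assms K lower upper[unfolded d0] \<tau>])+
qed

end
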